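(* Let $n\ge 3$, let $L$ be a finite-dimensional complex Leibniz algebra and let $I$ be the ideal of $L$ generated by all squares $[x,x]$, $x\in L$. Suppose that $L/I$ is isomorphic to $sl_n$ and that $\dim I=2$. Then $L=sl_n\oplus I$.
   Context: All vector spaces and algebras are finite-dimensional over $\mathbb{C}$. A (right) Leibniz algebra is an algebra $(L,[\cdot,\cdot])$ satisfying $[x,[y,z]]=[[x,y],z]-[[x,z],y]$ for all $x,y,z\in L$. By Levi's theorem for Leibniz algebras, $sl_n$ is regarded as a subalgebra of $L$ complementary to $I$. The symbol $\oplus$ denotes the direct sum of algebras, so $L=sl_n\oplus I$ means that $L$ is the vector space direct sum of $sl_n$ and $I$ with $[sl_n,I]=[I,sl_n]=0$. *)

theory Defs
  imports "HOL-Analysis.Analysis"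
begin

section \<open>Algebras with explicit carrier, and their isomorphisms\<close>

text \<open>
  Only a common format for subalgebras, quotients and \<open>sl\<^sub>n\<close>, so that one notion of isomorphism
  covers all of them; no axioms are attached to the record.
\<close>

record 'v cplx_alg =
  Carrier :: "'v set"
  Add :: "'v \<Rightarrow> 'v \<Rightarrow> 'v"
  Scale :: "complex \<Rightarrow> 'v \<Rightarrow> 'v"
  Bracket :: "'v \<Rightarrow> 'v \<Rightarrow> 'v"

definition alg_iso :: "'v cplx_alg \<Rightarrow> 'w cplx_alg \<Rightarrow> ('v \<Rightarrow> 'w) \<Rightarrow> bool" where
  "alg_iso A B f \<longleftrightarrow>
     bij_betw f (Carrier A) (Carrier B) \<and>
     (\<forall>x\<in>Carrier A. \<forall>y\<in>Carrier A. f (Add A x y) = Add B (f x) (f y)) \<and>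
     (\<forall>c. \<forall>x\<in>Carrier A. f (Scale A c x) = Scale B c (f x)) \<and>
     (\<forall>x\<in>Carrier A. \<forall>y\<in>Carrier A. f (Bracket A x y) = Bracket B (f x) (f y))"

definition alg_isomorphic :: "'v cplx_alg \<Rightarrow> 'w cplx_alg \<Rightarrow> bool" where
  "alg_isomorphic A B \<longleftrightarrow> (\<exists>f. alg_iso A B f)"

definition sl :: "(complex^'n^'n) cplx_alg" where
  "sl = \<lparr> Carrier = {A. trace A = 0},
          Add = (+),
          Scale = (\<lambda>c A. \<chi> i j. c * A $ i $ j),
          Bracket = (\<lambda>A B. A ** B - B ** A) \<rparr>"


section \<open>Complex Leibniz algebras\<close>

locale complex_algebra = vector_space sc
  for sc :: "complex \<Rightarrow> 'a::ab_group_add \<Rightarrow> 'a" +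
  fixes br :: "'a \<Rightarrow> 'a \<Rightarrow> 'a"
  assumes linear_left: "Vector_Spaces.linear sc sc (\<lambda>x. br x y)"
    and linear_right: "Vector_Spaces.linear sc sc (\<lambda>y. br x y)"
begin

definition subalgebra :: "'a set \<Rightarrow> bool" where
  "subalgebra S \<longleftrightarrow> subspace S \<and> (\<forall>x\<in>S. \<forall>y\<in>S. br x y \<in> S)"

definition alg_ideal :: "'a set \<Rightarrow> bool" where
  "alg_ideal J \<longleftrightarrow> subspace J \<and> (\<forall>x\<in>J. \<forall>y. br x y \<in> J \<and> br y x \<in> J)"

definition sub_alg :: "'a set \<Rightarrow> 'a cplx_alg" where
  "sub_alg S = \<lparr> Carrier = S, Add = (+), Scale = sc, Bracket = br \<rparr>"

definition coset :: "'a set \<Rightarrow> 'a \<Rightarrow> 'a set" where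
  "coset J x = (\<lambda>j. x + j) ` J"

text \<open>
  The unions below run over all choices of representatives; when \<open>J\<close> is an ideal, every choice
  gives the same coset, see the lemmas that follow.
\<close>

definition quot_alg :: "'a set \<Rightarrow> 'a set cplx_alg" where
  "quot_alg J = \<lparr> Carrier = range (coset J),
                  Add = (\<lambda>X Y. \<Union>x\<in>X. \<Union>y\<in>Y. coset J (x + y)),
                  Scale = (\<lambda>c X. \<Union>x\<in>X. coset J (sc c x)),
                  Bracket = (\<lambda>X Y. \<Union>x\<in>X. \<Union>y\<in>Y. coset J (br x y)) \<rparr>"

definition vs_complement :: "'a set \<Rightarrow> 'a set \<Rightarrow> bool" where
  "vs_complement S J \<longleftrightarrow> S \<inter> J = {0} \<and> (\<forall>x. \<exists>s\<in>S. \<exists>j\<in>J. x = s + j)"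

definition alg_direct_sum :: "'a set \<Rightarrow> 'a set \<Rightarrow> bool" where
  "alg_direct_sum S J \<longleftrightarrow> subalgebra S \<and> subalgebra J \<and> vs_complement S J \<and>
     (\<forall>s\<in>S. \<forall>j\<in>J. br s j = 0 \<and> br j s = 0)"

definition squares_ideal :: "'a set" where
  "squares_ideal = alg_ideal hull (range (\<lambda>x. br x x))"

lemma alg_ideal_squares_ideal: "alg_ideal squares_ideal"
  unfolding squares_ideal_def
  by (rule hull_in) (auto simp: alg_ideal_def subspace_def)

lemma mem_coset: "z \<in> coset J x \<longleftrightarrow> z - x \<in> J"
proof -
  have "z - x \<in> J \<Longrightarrow> z = x + (z - x)" by simp
  then show ?thesis by (auto simp only: coset_def image_iff add_diff_cancel_left')
qed

lemma coset_eq_iff: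
  assumes "alg_ideal J"
  shows "coset J x = coset J y \<longleftrightarrow> x - y \<in> J"
proof
  assume "coset J x = coset J y"
  moreover have "x \<in> coset J x"
    using assms by (simp add: mem_coset alg_ideal_def subspace_0)
  ultimately show "x - y \<in> J" by (simp add: mem_coset)
next
  assume xy: "x - y \<in> J"
  have J: "subspace J" using assms by (simp add: alg_ideal_def)
  have "z - x \<in> J \<longleftrightarrow> z - y \<in> J" for z
    using subspace_add[OF J xy, of "z - x"] subspace_diff[OF J _ xy, of "z - y"] by auto
  then show "coset J x = coset J y" by (auto simp: mem_coset)
qed

lemma
  assumes J: "alg_ideal J"
  shows quot_add: "Add (quot_alg J) (coset J x) (coset J y) = coset J (x + y)"
    and quot_scale: "Scale (quot_alg J) c (coset J x) = coset J (sc c x)"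
    and quot_bracket: "Bracket (quot_alg J) (coset J x) (coset J y) = coset J (br x y)"
proof -
  have S: "subspace J" using J by (simp add: alg_ideal_def)
  have self: "u \<in> coset J u" for u using subspace_0[OF S] by (simp add: mem_coset)
  have 1: "coset J (u + v) = coset J (x + y)" if "u \<in> coset J x" "v \<in> coset J y" for u v
    using subspace_add[OF S, of "u - x" "v - y"] that
    by (simp add: mem_coset coset_eq_iff[OF J] algebra_simps)
  have 2: "coset J (sc c u) = coset J (sc c x)" if "u \<in> coset J x" for u
    using subspace_scale[OF S, of "u - x" c] that
    by (simp add: mem_coset coset_eq_iff[OF J] scale_right_diff_distrib)
  have 3: "coset J (br u v) = coset J (br x y)" if "u \<in> coset J x" "v \<in> coset J y" for u v
  proof -
    have "br (u - x) v = br u v - br x v" "br x (v - y) = br x v - br x y"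
      by (rule module_hom.diff[OF Vector_Spaces.linear.axioms(3)[OF linear_left]],
          rule module_hom.diff[OF Vector_Spaces.linear.axioms(3)[OF linear_right]])
    moreover have "br (u - x) v \<in> J" "br x (v - y) \<in> J"
      using that J by (auto simp: mem_coset alg_ideal_def)
    ultimately show ?thesis
      using subspace_add[OF S, of "br (u - x) v" "br x (v - y)"]
      by (simp add: coset_eq_iff[OF J])
  qed
  show "Add (quot_alg J) (coset J x) (coset J y) = coset J (x + y)"
    unfolding quot_alg_def cplx_alg.simps using self[of x] self[of y] 1 by blast
  show "Scale (quot_alg J) c (coset J x) = coset J (sc c x)"
    unfolding quot_alg_def cplx_alg.simps using self[of x] 2 by blast
  show "Bracket (quot_alg J) (coset J x) (coset J y) = coset J (br x y)"
    unfolding quot_alg_def cplx_alg.simps using self[of x] self[of y] 3 by blast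
qed

end

locale fd_leibniz_algebra = complex_algebra +
  assumes finite_dimensional: "\<exists>B. finite B \<and> span B = UNIV"
    and leibniz: "br x (br y z) = br (br x y) z - br (br x z) y"

end

theory Submission
  imports Defs
begin

text \<open>
  The hypotheses turn out to be contradictory, so the decomposition holds vacuously.
  Since \<open>L\<close> acts trivially on \<open>I\<close> from the left, the right action makes \<open>I\<close> a two-dimensional
  representation of \<open>sl\<^sub>n\<close>. There \<open>E\<^sub>1\<^sub>2\<close> and \<open>E\<^sub>1\<^sub>3\<close> commute and have opposite weights with respect to
  \<open>E\<^sub>2\<^sub>2 - E\<^sub>3\<^sub>3\<close>, so one of them acts by zero; as \<open>sl\<^sub>n\<close> is simple, \<open>I\<close> is central. Then
  \<open>\<sigma>(x, y) = [x, y] + [y, x]\<close> induces an invariant form on \<open>sl\<^sub>n\<close> with values in \<open>I\<close>. The Leibniz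
  identity for an \<open>sl\<^sub>2\<close>-triple \<open>e, f, h\<close> gives \<open>[h, h] = 0\<close> and then \<open>\<sigma>(e, f) = 0\<close>. With
  \<open>[e, [e, y]] = - 2 y\<^sub>2\<^sub>1 e\<close> this puts \<open>e\<close> into the radical of \<open>\<sigma>\<close>, an ideal. Hence \<open>\<sigma> = 0\<close>, all
  squares vanish, and \<open>I = 0\<close> instead of having dimension 2.
\<close>

section \<open>Matrix units and ideals of the special linear Lie algebra\<close>

definition matrix_unit :: "'n \<Rightarrow> 'n \<Rightarrow> complex^'n^'n" where
  "matrix_unit i j = (\<chi> a b. if a = i \<and> b = j then 1 else 0)"

text \<open>The same formula as the \<open>Scale\<close> field of \<open>sl\<close>, so that
  statements about \<open>sl\<close> transfer verbatim.\<close>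

definition cmat_scale :: "complex \<Rightarrow> complex^'n^'m \<Rightarrow> complex^'n^'m" where
  "cmat_scale c A = (\<chi> i j. c * A $ i $ j)"

abbreviation commutator :: "complex^'n^'n \<Rightarrow> complex^'n^'n \<Rightarrow> complex^'n^'n" where
  "commutator A B \<equiv> A ** B - B ** A"

lemma matrix_diff_ldistrib: "A ** (B - C) = A ** B - A ** C"
  for A :: "'a::ring_1^'n^'m"
  by (simp add: vec_eq_iff matrix_matrix_mult_def right_diff_distrib sum_subtractf)

lemma matrix_diff_rdistrib: "(A - B) ** C = A ** C - B ** C"
  for A :: "'a::ring_1^'n^'m"
  by (simp add: vec_eq_iff matrix_matrix_mult_def left_diff_distrib sum_subtractf)

lemma matrix_unit_nth: "matrix_unit i j $ a $ b = (if a = i \<and> b = j then 1 else 0)"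
  by (simp add: matrix_unit_def)

lemma cmat_scale_nth: "cmat_scale c A $ a $ b = c * A $ a $ b"
  by (simp add: cmat_scale_def)

lemma matrix_unit_mult:
  "matrix_unit i j ** matrix_unit k l = (if j = k then matrix_unit i l else 0)"
proof -
  have "(\<Sum>c\<in>UNIV. matrix_unit i j $ a $ c * matrix_unit k l $ c $ b) =
      (\<Sum>c\<in>UNIV. if c = j then (if a = i \<and> j = k \<and> b = l then 1 else 0) else 0)" for a b
    by (intro sum.cong) (auto simp: matrix_unit_nth)
  then show ?thesis
    by (auto simp: vec_eq_iff matrix_matrix_mult_def matrix_unit_nth)
qed

text \<open>Only one entry of \<open>B\<close> survives between the two units. For i \<noteq> j the
  unit has square zero, so this computes its double commutator with \<open>B\<close>.\<close>

lemma matrix_unit_sandwich: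
  "matrix_unit i j ** B ** matrix_unit i j = cmat_scale (B $ j $ i) (matrix_unit i j)"
proof -
  have 1: "(matrix_unit i j ** B) $ a $ b = (if a = i then B $ j $ b else 0)" for a b
  proof -
    have "(\<Sum>c\<in>UNIV. matrix_unit i j $ a $ c * B $ c $ b) =
      (\<Sum>c\<in>UNIV. if c = j then (if a = i then B $ j $ b else 0) else 0)"
      by (intro sum.cong) (auto simp: matrix_unit_nth)
    then show ?thesis by (simp add: matrix_matrix_mult_def)
  qed
  have 2: "(A ** matrix_unit i j) $ a $ b = (if b = j then A $ a $ i else 0)"
    for A :: "complex^'a^'a" and a b
  proof -
    have "(\<Sum>c\<in>UNIV. A $ a $ c * matrix_unit i j $ c $ b) =
      (\<Sum>c\<in>UNIV. if c = i then (if b = j then A $ a $ i else 0) else 0)"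
      by (intro sum.cong) (auto simp: matrix_unit_nth)
    then show ?thesis by (simp add: matrix_matrix_mult_def)
  qed
  show ?thesis by (simp add: vec_eq_iff 1 2 cmat_scale_nth matrix_unit_nth)
qed

lemma trace_matrix_unit: "trace (matrix_unit i j) = (if i = j then 1 else 0)"
proof -
  have "(\<Sum>c\<in>UNIV. matrix_unit i j $ c $ c) = (\<Sum>c\<in>UNIV. if c = i then (if i = j then 1 else 0) else 0)"
    by (intro sum.cong) (auto simp: matrix_unit_nth)
  then show ?thesis by (simp add: trace_def)
qed

text \<open>Subtracting \<open>matrix_unit p p\<close> from every diagonal unit changes the usual
  expansion by a multiple of the trace, which is zero. Each summand is now itself traceless.\<close>

lemma traceless_eq_sum:
  assumes "trace A = 0"
  shows "A = (\<Sum>i\<in>UNIV. \<Sum>j\<in>UNIV.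
    cmat_scale (A $ i $ j) (matrix_unit i j - (if i = j then matrix_unit p p else 0)))"
proof -
  have "(\<Sum>i\<in>UNIV. \<Sum>j\<in>UNIV.
      A $ i $ j * (matrix_unit i j $ a $ b - (if i = j then matrix_unit p p $ a $ b else 0)))
    = A $ a $ b" for a b
  proof -
    have "(\<Sum>i\<in>UNIV. \<Sum>j\<in>UNIV.
        A $ i $ j * (matrix_unit i j $ a $ b - (if i = j then matrix_unit p p $ a $ b else 0)))
      = (\<Sum>i\<in>UNIV. \<Sum>j\<in>UNIV. (if j = b then (if i = a then A $ a $ b else 0) else 0)
          - (if j = i then A $ i $ i * matrix_unit p p $ a $ b else 0))"
      by (intro sum.cong) (auto simp: matrix_unit_nth)
    also have "\<dots> = A $ a $ b - trace A * matrix_unit p p $ a $ b"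
      by (simp add: sum_subtractf trace_def sum_distrib_right)
    finally show ?thesis using assms by simp
  qed
  then show ?thesis
    by (auto simp: vec_eq_iff cmat_scale_nth if_distrib[of "\<lambda>M. M $ _ $ _"] cong: if_cong)
qed

lemma obtain_third:
  fixes i j :: "'n::finite"
  assumes "CARD('n) \<ge> 3"
  obtains k where "k \<noteq> i" "k \<noteq> j"
proof -
  have "card {i, j} < CARD('n)" using assms card_insert_le_m1[of 2 "{j}" i] by simp
  then have "UNIV \<noteq> {i, j}" by auto
  then show ?thesis using that by blast
qed

text \<open>From [E_ij, E_jk] = E_ik and [E_ij, E_ki] = - E_kj the column and row index of a unit in
  \<open>M\<close> can be changed one at a time; [E_ip, E_pi] = E_ii - E_pp then supplies the
  diagonal part.\<close>

lemma sl_ideal_with_matrix_unit: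
  fixes M :: "(complex^'n::finite^'n) set"
  assumes n: "CARD('n) \<ge> 3"
    and add: "\<And>A B. A \<in> M \<Longrightarrow> B \<in> M \<Longrightarrow> A + B \<in> M"
    and scale: "\<And>c A. A \<in> M \<Longrightarrow> cmat_scale c A \<in> M"
    and ideal: "\<And>A B. A \<in> M \<Longrightarrow> trace B = 0 \<Longrightarrow> commutator A B \<in> M"
    and pq: "matrix_unit p q \<in> M" "p \<noteq> q"
    and A: "trace A = 0"
  shows "A \<in> M"
proof -
  have row: "matrix_unit i k \<in> M" if "matrix_unit i j \<in> M" "i \<noteq> j" "i \<noteq> k" for i j k
    using ideal[OF that(1), of "matrix_unit j k"] that
    by (cases "j = k") (auto simp: matrix_unit_mult trace_matrix_unit)
  have neg: "- A \<in> M" if "A \<in> M" for A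
    using scale[OF that, of "-1"] by (simp add: cmat_scale_def vec_eq_iff uminus_vec_def)
  have col: "matrix_unit k j \<in> M" if "matrix_unit i j \<in> M" "i \<noteq> j" "k \<noteq> j" for i j k
    using neg[OF ideal[OF that(1), of "matrix_unit k i"]] that
    by (cases "k = i") (auto simp: matrix_unit_mult trace_matrix_unit)
  have unit: "matrix_unit i j \<in> M" if "i \<noteq> j" for i j
  proof -
    \<comment> \<open>The route is (p, q), (p, k), (i, k), (i, j); a third index \<open>k\<close>
      keeps it off the diagonal.\<close>
    obtain k where k: "k \<noteq> p" "k \<noteq> i" using obtain_third[OF n] by blast
    have "matrix_unit p k \<in> M" using row[OF pq] k by auto
    then have "matrix_unit i k \<in> M" using col[of p k i] k by auto
    then show ?thesis using row[of i k j] k that by auto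
  qed
  have diag: "matrix_unit i i - matrix_unit p p \<in> M" if "i \<noteq> p" for i
    using ideal[OF unit[OF that], of "matrix_unit p i"] that
    by (simp add: matrix_unit_mult trace_matrix_unit)
  have zero: "0 \<in> M" using scale[OF pq(1), of 0]
    by (simp add: cmat_scale_def vec_eq_iff zero_vec_def)
  have sum: "sum f S \<in> M" if "\<And>s. f s \<in> M" for f :: "'n \<Rightarrow> _" and S
    by (induction S rule: infinite_finite_induct) (auto simp: zero add that)
  have "matrix_unit i j - (if i = j then matrix_unit p p else 0) \<in> M" for i j
    using unit[of i j] diag[of i] zero by (cases "i = p") auto
  then have "(\<Sum>i\<in>UNIV. \<Sum>j\<in>UNIV.
      cmat_scale (A $ i $ j) (matrix_unit i j - (if i = j then matrix_unit p p else 0))) \<in> M"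
    by (intro sum scale)
  then show ?thesis using traceless_eq_sum[OF A, of p] by simp
qed


section \<open>Two-dimensional representations\<close>

text \<open>
  Here \<open>f\<close> and \<open>g\<close> have matrices \<open>(a, p; q, a')\<close> and \<open>(b, r; s, b')\<close>. Both are commutators, hence
  traceless, and commuting traceless \<open>2 \<times> 2\<close> matrices are proportional; opposite weights rule
  this out unless one of them vanishes.
\<close>
lemma commuting_opposite_weights_coefficients:
  fixes a p q a' b r s b' c m n c' :: "'a::field"
  assumes two: "(2::'a) \<noteq> 0"
    and f: "c * a + m * q - (a * c + p * n) = - a" "c * p + m * a' - (a * m + p * c') = - p"
      "n * a + c' * q - (q * c + a' * n) = - q" "n * p + c' * a' - (q * m + a' * c') = - a'"
    and g: "c * b + m * s - (b * c + r * n) = b" "c * r + m * b' - (b * m + r * c') = r"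
      "n * b + c' * s - (s * c + b' * n) = s" "n * r + c' * b' - (s * m + b' * c') = b'"
    and fg: "b * a + r * q = a * b + p * s" "b * p + r * a' = a * r + p * b'"
      "s * a + b' * q = q * b + a' * s"
  shows "a = 0 \<and> p = 0 \<and> q = 0 \<and> a' = 0 \<or> b = 0 \<and> r = 0 \<and> s = 0 \<and> b' = 0"
proof -
  have cancel: "x = 0" if "x = - x" for x :: 'a
  proof -
    have "2 * x = 0" using that by (metis mult_2 add.right_inverse)
    then show ?thesis using two by simp
  qed
  \<comment> \<open>The diagonal entries of a commutator are opposite to each other, which makes
    both matrices traceless.\<close>
  have "m * q - p * n = - a" "p * n - m * q = - a'" using f(1,4) by (simp_all add: algebra_simps)
  then have a': "a' = - a" by (metis minus_diff_eq minus_minus)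
  have "m * s - r * n = b" "r * n - m * s = b'" using g(1,4) by (simp_all add: algebra_simps)
  then have b': "b' = - b" by (metis minus_diff_eq)
  have f': "m * q - p * n = - a" "p * (c - c') - (m * a + m * a) = - p"
      "n * a + n * a - q * (c - c') = - q"
    using f(1,2,3) unfolding a' by (simp_all only: mult_minus_left mult_minus_right) (simp_all add: algebra_simps)
  have g': "m * s - r * n = b" "r * (c - c') - (m * b + m * b) = r"
      "n * b + n * b - s * (c - c') = s"
    using g(1,2,3) unfolding b' by (simp_all only: mult_minus_left mult_minus_right) (simp_all add: algebra_simps)
  have rq: "r * q = p * s" using fg(1) by (simp add: algebra_simps)
  have "b * p - a * r = - (b * p - a * r)" using fg(2) a' b' by (simp add: algebra_simps)
  then have bp: "b * p = a * r" using cancel[of "b * p - a * r"] by simp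
  have "s * a - b * q = - (s * a - b * q)" using fg(3) a' b' by (simp add: algebra_simps)
  then have sa: "s * a = b * q" using cancel[of "s * a - b * q"] by simp
  \<comment> \<open>The weight equation of \<open>g\<close> is inserted for \<open>b\<close>,
    proportionality moves the factors across, and the weight equation of \<open>f\<close> comes out
    with the opposite sign. The products \<open>p * r\<close> and \<open>q * s\<close> are treated
    in the same way.\<close>
  have "a * b = m * (s * a) - n * (a * r)"
    unfolding g'(1)[symmetric] by (simp add: algebra_simps)
  also have "\<dots> = b * (m * q - p * n)"
    unfolding sa bp[symmetric] by (simp add: algebra_simps)
  finally have "a * b = - (a * b)" unfolding f'(1) by (simp add: mult.commute)
  then have ab: "a * b = 0" by (rule cancel)
  have "p * r = p * (r * (c - c') - (m * b + m * b))" by (simp only: g'(2))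
  also have "\<dots> = r * (p * (c - c')) - (m * (b * p) + m * (b * p))" by (simp add: algebra_simps)
  also have "\<dots> = r * (p * (c - c') - (m * a + m * a))" unfolding bp by (simp add: algebra_simps)
  finally have "p * r = - (p * r)" unfolding f'(2) by (simp add: mult.commute)
  then have pr: "p * r = 0" by (rule cancel)
  have "q * s = q * (n * b + n * b - s * (c - c'))" by (simp only: g'(3))
  also have "\<dots> = n * (b * q) + n * (b * q) - s * (q * (c - c'))" by (simp add: algebra_simps)
  also have "\<dots> = s * (n * a + n * a - q * (c - c'))" unfolding sa[symmetric] by (simp add: algebra_simps)
  finally have "q * s = - (q * s)" unfolding f'(3) by (simp add: mult.commute)
  then have qs: "q * s = 0" by (rule cancel)
  show ?thesis
  proof (cases "a = 0 \<and> p = 0 \<and> q = 0")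
    case True
    then show ?thesis using a' by simp
  next
    case False
    \<comment> \<open>Whichever of \<open>a\<close>, \<open>p\<close>, \<open>q\<close> is nonzero
      forces its partner among \<open>b\<close>, \<open>r\<close>, \<open>s\<close> to vanish, and
      proportionality then kills the other two.\<close>
    then have "b = 0 \<and> r = 0 \<and> s = 0" using rq bp sa ab pr qs by (metis mult_eq_0_iff)
    then show ?thesis using b' by simp
  qed
qed

text \<open>In a basis of \<open>V\<close> the operator relations become the scalar equations of the
  preceding lemma. The operators will be right multiplications on the ideal of squares.\<close>

lemma (in vector_space) commuting_opposite_weights_dim_2:
  assumes two: "(2::'a) \<noteq> 0"
    and V: "subspace V" "dim V = 2"
    and lin: "Vector_Spaces.linear scale scale f" "Vector_Spaces.linear scale scale g"
      "Vector_Spaces.linear scale scale k"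
    and maps: "\<And>w. w \<in> V \<Longrightarrow> f w \<in> V" "\<And>w. w \<in> V \<Longrightarrow> g w \<in> V" "\<And>w. w \<in> V \<Longrightarrow> k w \<in> V"
    and fk: "\<And>w. w \<in> V \<Longrightarrow> f (k w) - k (f w) = - f w"
    and gk: "\<And>w. w \<in> V \<Longrightarrow> g (k w) - k (g w) = g w"
    and fg: "\<And>w. w \<in> V \<Longrightarrow> f (g w) = g (f w)"
  shows "(\<forall>w\<in>V. f w = 0) \<or> (\<forall>w\<in>V. g w = 0)"
proof -
  obtain B where B: "B \<subseteq> V" "independent B" "V \<subseteq> span B" "card B = 2"
    using basis_exists[of V] V(2) by metis
  then obtain u v where uv: "B = {u, v}" "u \<noteq> v" by (auto simp: card_2_iff)
  have uV: "u \<in> V" and vV: "v \<in> V" using B uv by auto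
  define L where "L x y = scale x u + scale y v" for x y
  have repr: "\<exists>x y. w = L x y" if "w \<in> V" for w
  proof -
    have "w \<in> span {u, v}" using that B uv by auto
    then obtain x where "w - scale x u \<in> span {v}" using span_breakdown_eq by metis
    then obtain y where "w - scale x u = scale y v" by (auto simp: span_singleton)
    then have "w = L x y" by (simp add: L_def algebra_simps)
    then show ?thesis by blast
  qed
  have zero: "x = 0 \<and> y = 0" if "L x y = 0" for x y
  proof -
    have "(\<Sum>b\<in>{u, v}. scale (if b = u then x else y) b) = 0"
      using that uv(2) by (auto simp: L_def)
    then have "(if b = u then x else y) = 0" if "b \<in> {u, v}" for b
      using independentD[OF B(2), of "{u, v}" "\<lambda>b. if b = u then x else y"] uv(1) that by simp
    from this[of u] this[of v] show ?thesis using uv(2) by auto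
  qed
  have diff: "L x y - L x' y' = L (x - x') (y - y')"
    and neg: "- L x y = L (- x) (- y)" for x y x' y'
    by (simp_all add: L_def scale_left_diff_distrib)
  have inj: "x = x' \<and> y = y'" if "L x y = L x' y'" for x y x' y'
    using zero[of "x - x'" "y - y'"] that diff[of x y x' y'] by simp
  have app: "h (L x y) = L (x * x1 + y * x3) (x * x2 + y * x4)"
    if "Vector_Spaces.linear scale scale h" "h u = L x1 x2" "h v = L x3 x4" for h x y x1 x2 x3 x4
    using that(2,3) module_hom.add[OF Vector_Spaces.linear.axioms(3)[OF that(1)]]
      module_hom.scale[OF Vector_Spaces.linear.axioms(3)[OF that(1)]]
    by (simp add: L_def algebra_simps)
  \<comment> \<open>The images of \<open>u\<close> and \<open>v\<close> are the rows of the
    matrices.\<close>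
  obtain a p where fu: "f u = L a p" using repr maps uV by blast
  obtain q a' where fv: "f v = L q a'" using repr maps vV by blast
  obtain b r where gu: "g u = L b r" using repr maps uV by blast
  obtain s b' where gv: "g v = L s b'" using repr maps vV by blast
  obtain c m where ku: "k u = L c m" using repr maps uV by blast
  obtain n c' where kv: "k v = L n c'" using repr maps vV by blast
  note apps = app[OF lin(1) fu fv] app[OF lin(2) gu gv] app[OF lin(3) ku kv] diff neg
  have f: "c * a + m * q - (a * c + p * n) = - a \<and> c * p + m * a' - (a * m + p * c') = - p"
      "n * a + c' * q - (q * c + a' * n) = - q \<and> n * p + c' * a' - (q * m + a' * c') = - a'"
    using fk[OF uV] fk[OF vV] unfolding fu fv ku kv apps by (blast dest: inj)+
  have g: "c * b + m * s - (b * c + r * n) = b \<and> c * r + m * b' - (b * m + r * c') = r"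
      "n * b + c' * s - (s * c + b' * n) = s \<and> n * r + c' * b' - (s * m + b' * c') = b'"
    using gk[OF uV] gk[OF vV] unfolding gu gv ku kv apps by (blast dest: inj)+
  have fg': "b * a + r * q = a * b + p * s \<and> b * p + r * a' = a * r + p * b'"
      "s * a + b' * q = q * b + a' * s \<and> s * p + b' * a' = q * r + a' * b'"
    using fg[OF uV] fg[OF vV] unfolding fu fv gu gv apps by (blast dest: inj)+
  have "a = 0 \<and> p = 0 \<and> q = 0 \<and> a' = 0 \<or> b = 0 \<and> r = 0 \<and> s = 0 \<and> b' = 0"
    by (rule commuting_opposite_weights_coefficients[OF two]) (use f g fg' in blast)+
  then show ?thesis
  proof
    assume "a = 0 \<and> p = 0 \<and> q = 0 \<and> a' = 0"
    then have "f (L x y) = 0" for x y by (simp add: apps) (simp add: L_def)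
    then show ?thesis using repr by metis
  next
    assume "b = 0 \<and> r = 0 \<and> s = 0 \<and> b' = 0"
    then have "g (L x y) = 0" for x y by (simp add: apps) (simp add: L_def)
    then show ?thesis using repr by metis
  qed
qed


section \<open>Leibniz extensions of the special linear Lie algebra\<close>

context complex_algebra
begin

lemma br_add_left: "br (x + y) z = br x z + br y z"
  and br_scale_left: "br (sc c x) z = sc c (br x z)"
  and br_diff_left: "br (x - y) z = br x z - br y z"
  and br_zero_left: "br 0 z = 0"
  using linear_left[THEN Vector_Spaces.linear.axioms(3)]
  by (rule module_hom.add module_hom.scale module_hom.diff module_hom.zero)+

lemma br_add_right: "br z (x + y) = br z x + br z y"
  and br_scale_right: "br z (sc c x) = sc c (br z x)"
  and br_diff_right: "br z (x - y) = br z x - br z y"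
  and br_zero_right: "br z 0 = 0"
  using linear_right[THEN Vector_Spaces.linear.axioms(3)]
  by (rule module_hom.add module_hom.scale module_hom.diff module_hom.zero)+

lemma square_in_squares_ideal: "br x x \<in> squares_ideal"
  unfolding squares_ideal_def by (rule hull_inc) simp

lemma symmetrization_in_squares_ideal: "br x y + br y x \<in> squares_ideal"
proof -
  have S: "subspace squares_ideal" using alg_ideal_squares_ideal by (simp add: alg_ideal_def)
  have "br x y + br y x = br (x + y) (x + y) - br x x - br y y"
    by (simp add: br_add_left br_add_right)
  then show ?thesis using S by (simp add: subspace_diff square_in_squares_ideal)
qed

lemma squares_ideal_subset:
  assumes "alg_ideal J" "\<And>x. br x x \<in> J"
  shows "squares_ideal \<subseteq> J"
  unfolding squares_ideal_def using assms by (intro hull_minimal) auto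

end

text \<open>The elements annihilated by all left multiplications form an ideal, and it contains
  every square because the two terms of the Leibniz identity cancel for y = z.\<close>

lemma (in fd_leibniz_algebra) br_squares_ideal_right:
  assumes "z \<in> squares_ideal"
  shows "br x z = 0"
proof -
  have "alg_ideal {z. \<forall>x. br x z = 0}"
    by (auto simp: alg_ideal_def subspace_def br_add_right br_scale_right br_zero_right leibniz
        br_zero_left)
  then have "squares_ideal \<subseteq> {z. \<forall>x. br x z = 0}"
    by (rule squares_ideal_subset) (simp add: leibniz)
  then show ?thesis using assms by blast
qed

text \<open>The isomorphism of the quotient with sl_n, recast as a homomorphism from
  \<open>L\<close> onto the traceless matrices with kernel \<open>squares_ideal\<close>, so that
  calculations can use elements instead of cosets.\<close>

locale sl_leibniz_extension = fd_leibniz_algebra sc br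
  for sc :: "complex \<Rightarrow> 'a::ab_group_add \<Rightarrow> 'a" and br +
  fixes proj :: "'a \<Rightarrow> complex^'n::finite^'n"
  assumes proj_add: "proj (x + y) = proj x + proj y"
    and proj_scale: "proj (sc c x) = cmat_scale c (proj x)"
    and proj_br: "proj (br x y) = commutator (proj x) (proj y)"
    and range_proj: "range proj = {A. trace A = 0}"
    and proj_eq: "proj x = proj y \<longleftrightarrow> x - y \<in> squares_ideal"
    and three: "CARD('n) \<ge> 3"
begin

lemma subspace_squares_ideal: "subspace squares_ideal"
  using alg_ideal_squares_ideal by (simp add: alg_ideal_def)

lemma trace_proj: "trace (proj x) = 0"
  using range_proj by blast

lemma proj_lift:
  assumes "trace A = 0"
  obtains x where "proj x = A"
  using assms range_proj by (metis (mono_tags, lifting) mem_Collect_eq imageE)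

text \<open>The image of \<open>N\<close> is an ideal of sl_n containing an off-diagonal unit, hence
  everything; since \<open>N\<close> also contains the kernel of \<open>proj\<close>, it is the
  whole algebra.\<close>

lemma ideal_with_matrix_unit:
  assumes N: "subspace N" "squares_ideal \<subseteq> N" "\<And>x y. x \<in> N \<Longrightarrow> br x y \<in> N"
    and x: "x \<in> N" "proj x = matrix_unit p q" "p \<noteq> q"
  shows "y \<in> N"
proof -
  have "proj y \<in> proj ` N"
  proof (rule sl_ideal_with_matrix_unit[OF three])
    show "A + B \<in> proj ` N" if "A \<in> proj ` N" "B \<in> proj ` N" for A B
      using that subspace_add[OF N(1)] by (force simp flip: proj_add)
    show "cmat_scale c A \<in> proj ` N" if "A \<in> proj ` N" for c A
      using that subspace_scale[OF N(1)] by (force simp flip: proj_scale)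
    show "commutator A B \<in> proj ` N" if A: "A \<in> proj ` N" and B: "trace B = 0" for A B
    proof -
      obtain z where "proj z = B" using proj_lift[OF B] .
      then show ?thesis using A N(3) by (force simp flip: proj_br)
    qed
    show "matrix_unit p q \<in> proj ` N" using x by (metis imageI)
  qed (use x trace_proj in auto)
  then obtain z where z: "z \<in> N" "y - z \<in> squares_ideal" by (auto simp: proj_eq)
  then show ?thesis using N(2) subspace_add[OF N(1), of z "y - z"] by auto
qed

text \<open>Right multiplication thus depends only on the class modulo the ideal, so relations in
  sl_n may be used in the right argument.\<close>

lemma br_cong_mod_squares_ideal: "proj y = proj z \<Longrightarrow> br x y = br x z"
  using br_squares_ideal_right[of "y - z" x] by (simp add: proj_eq br_diff_right)

lemma squares_ideal_left_annihilated:
  assumes dim: "dim squares_ideal = 2" and z: "z \<in> squares_ideal"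
  shows "br z x = 0"
proof -
  obtain p q :: 'n where q: "q \<noteq> p" using obtain_third[OF three] by metis
  obtain r :: 'n where r: "r \<noteq> p" "r \<noteq> q" using obtain_third[OF three] by blast
  \<comment> \<open>As \<open>p\<close>, \<open>q\<close>, \<open>r\<close> are distinct, [H, E_pq]
    = - E_pq and [H, E_pr] = E_pr, while E_pq and E_pr commute.\<close>
  define H :: "complex^'n^'n" where "H = matrix_unit q q - matrix_unit r r"
  obtain e where e: "proj e = matrix_unit p q" using proj_lift[of "matrix_unit p q"] q
    by (auto simp: trace_matrix_unit)
  obtain e' where e': "proj e' = matrix_unit p r" using proj_lift[of "matrix_unit p r"] r
    by (auto simp: trace_matrix_unit)
  obtain h where h: "proj h = H" using proj_lift[of H]
    by (auto simp: trace_matrix_unit H_def trace_sub)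
  have neg: "proj (- x) = - proj x" for x
    using proj_scale[of "-1" x] by (simp add: cmat_scale_def vec_eq_iff uminus_vec_def)
  have zero: "proj 0 = 0"
    using proj_add[of 0 0] by simp
  have he: "proj (br h e) = proj (- e)" and he': "proj (br h e') = proj e'"
    and ee': "proj (br e e') = proj 0"
    using q r by (auto simp: proj_br e e' h neg H_def matrix_unit_mult matrix_diff_ldistrib
      matrix_diff_rdistrib zero)
  \<comment> \<open>The kernel of the right action on the ideal of squares; one off-diagonal unit in
    its image suffices.\<close>
  define N where "N = {x. \<forall>w\<in>squares_ideal. br w x = 0}"
  have sq: "br w x \<in> squares_ideal" if "w \<in> squares_ideal" for w x
    using that alg_ideal_squares_ideal by (simp add: alg_ideal_def)
  have N: "subspace N" "squares_ideal \<subseteq> N" "\<And>x y. x \<in> N \<Longrightarrow> br x y \<in> N"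
    using br_squares_ideal_right
    by (auto simp: N_def subspace_def br_zero_right br_add_right br_scale_right leibniz sq
      br_zero_left)
  have neg_right: "br x (- y) = - br x y" for x y
    using br_diff_right[of x 0 y] by (simp add: br_zero_right)
  have "(\<forall>w\<in>squares_ideal. br w e = 0) \<or> (\<forall>w\<in>squares_ideal. br w e' = 0)"
  \<comment> \<open>The Leibniz identity turns each bracket relation among \<open>h\<close>,
    \<open>e\<close>, \<open>e'\<close> into a commutator relation of right multiplications.\<close>
  proof (rule commuting_opposite_weights_dim_2[where k = "\<lambda>w. br w h"])
    fix w
    show "br (br w h) e - br (br w e) h = - br w e"
      using br_cong_mod_squares_ideal[OF he, of w] by (simp add: leibniz neg_right)
    show "br (br w h) e' - br (br w e') h = br w e'"
      using br_cong_mod_squares_ideal[OF he', of w] by (simp add: leibniz)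
    show "br (br w e') e = br (br w e) e'"
      using br_cong_mod_squares_ideal[OF ee', of w] by (simp add: leibniz br_zero_right)
  qed (auto simp: dim subspace_squares_ideal linear_left sq)
  then have "x \<in> N"
    using ideal_with_matrix_unit[OF N _ e, of x] ideal_with_matrix_unit[OF N _ e', of x] q r
    by (auto simp: N_def)
  then show ?thesis using z by (simp add: N_def)
qed

lemma squares_vanish:
  assumes central: "\<And>z x. z \<in> squares_ideal \<Longrightarrow> br z x = 0"
  shows "br x x = 0"
proof -
  \<comment> \<open>The polarization of the square: \<open>\<sigma> x x\<close> is twice
    \<open>br x x\<close>.\<close>
  define \<sigma> where "\<sigma> x y = br x y + br y x" for x y
  have cong: "br x y = br x' y'" if "proj x = proj x'" "proj y = proj y'" for x x' y y'
    using br_cong_mod_squares_ideal[OF that(2), of x] central[of "x - x'" y'] that(1)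
    by (simp add: proj_eq br_diff_left)
  have \<sigma>_cong: "\<sigma> x y = \<sigma> x' y'" if "proj x = proj x'" "proj y = proj y'" for x x' y y'
    using cong that unfolding \<sigma>_def by metis
  have \<sigma>_commute: "\<sigma> x y = \<sigma> y x" for x y by (simp add: \<sigma>_def add.commute)
  \<comment> \<open>The bracket is antisymmetric modulo the ideal of squares, which annihilates from
    both sides.\<close>
  have anti: "br (br x y) z = - br (br y x) z" "br z (br x y) = - br z (br y x)" for x y z
    using central[OF symmetrization_in_squares_ideal[of x y], of z]
      br_squares_ideal_right[OF symmetrization_in_squares_ideal[of x y], of z]
    by (simp_all add: br_add_left br_add_right eq_neg_iff_add_eq_0)
  have inv: "\<sigma> x (br y z) = \<sigma> (br x y) z" for x y z
    using anti(1)[of x z y] anti(1)[of y z x] by (simp add: \<sigma>_def leibniz)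
  have \<sigma>_add: "\<sigma> (x + x') y = \<sigma> x y + \<sigma> x' y" and \<sigma>_scale: "\<sigma> (sc c x) y = sc c (\<sigma> x y)"
    for c x x' y
    by (simp_all add: \<sigma>_def br_add_left br_add_right br_scale_left br_scale_right scale_right_distrib)
  \<comment> \<open>The radical of \<open>\<sigma>\<close>; invariance makes it closed under
    brackets.\<close>
  define N where "N = {x. \<forall>y. \<sigma> x y = 0}"
  have N: "subspace N" "squares_ideal \<subseteq> N" "\<And>x y. x \<in> N \<Longrightarrow> br x y \<in> N"
  proof -
    have "\<sigma> 0 y = 0" for y by (simp add: \<sigma>_def br_zero_left br_zero_right)
    then show "subspace N" by (auto simp: N_def subspace_def \<sigma>_add \<sigma>_scale)
    show "squares_ideal \<subseteq> N" using br_squares_ideal_right central by (auto simp: N_def \<sigma>_def)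
    show "br x y \<in> N" if "x \<in> N" for x y using that by (simp add: N_def flip: inv)
  qed
  obtain p q :: 'n where pq: "p \<noteq> q" using obtain_third[OF three] by metis
  obtain e where e: "proj e = matrix_unit p q" using proj_lift[of "matrix_unit p q"] pq
    by (auto simp: trace_matrix_unit)
  obtain f where f: "proj f = matrix_unit q p" using proj_lift[of "matrix_unit q p"] pq
    by (auto simp: trace_matrix_unit)
  have 2: "cmat_scale 2 A = A + A" "cmat_scale (-2) A = - A - A" for A :: "complex^'n^'n"
    by (simp_all add: cmat_scale_def vec_eq_iff)
  define h where "h = br e f"
  have h: "proj h = matrix_unit p p - matrix_unit q q"
    by (simp add: h_def proj_br e f matrix_unit_mult)
  have eh: "proj (br e h) = proj (sc (-2) e)" and fh: "proj (br f h) = proj (sc 2 f)"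
    and he: "proj (br h e) = proj (sc 2 e)" and hf: "proj (br h f) = proj (sc (-2) f)"
    using pq by (auto simp: proj_br proj_scale e f h matrix_unit_mult matrix_diff_ldistrib
      matrix_diff_rdistrib 2 simp del: scale_minus_left)
  \<comment> \<open>Expanding [e, [f, h]] gives 2[e, f] = [h, h] + 2[e, f].\<close>
  have "br e (sc 2 f) = br h h - br (sc (-2) e) f"
    using leibniz[of e f h] cong[OF refl fh, of e] cong[OF eh refl, of f] by (simp add: h_def)
  then have hh: "br h h = 0" unfolding br_scale_left br_scale_right by simp
  \<comment> \<open>Expanding [h, [e, f]] instead gives [h, h] = 2[e, f] + 2[f, e].\<close>
  have "br h h = br (sc 2 e) f - br (sc (-2) f) e"
    using leibniz[of h e f] cong[OF he refl, of f] cong[OF hf refl, of e] by (simp add: h_def)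
  then have "sc 2 (\<sigma> e f) = 0"
    unfolding br_scale_left hh \<sigma>_def by (simp add: scale_right_distrib)
  then have ef: "\<sigma> e f = 0" by simp
  have "\<sigma> e y = 0" for y
  proof -
    have 1: "proj (br e (br e y)) = proj (sc (- 2 * proj y $ q $ p) e)"
    proof -
      have "proj y ** matrix_unit p q ** matrix_unit p q = 0"
        using pq by (simp add: matrix_unit_mult flip: matrix_mul_assoc)
      then have "proj (br e (br e y)) = cmat_scale (-2) (matrix_unit p q ** proj y ** matrix_unit p q)"
        using pq by (simp add: proj_br e matrix_diff_ldistrib matrix_diff_rdistrib
          matrix_mul_assoc matrix_unit_mult 2)
      also have "\<dots> = proj (sc (- 2 * proj y $ q $ p) e)"
        unfolding proj_scale e matrix_unit_sandwich by (simp add: cmat_scale_def vec_eq_iff)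
      finally show ?thesis .
    qed
    have 2: "proj (br (br f e) e) = proj (sc (-2) e)"
      using pq by (simp add: proj_br proj_scale e f matrix_diff_ldistrib matrix_diff_rdistrib
        matrix_unit_mult 2 del: scale_minus_left)
    \<comment> \<open>Invariance, applied twice, moves both factors \<open>e\<close> to the other
      argument. The left side is a multiple of \<open>\<sigma> e f\<close>, which is zero, and the
      right side is \<open>\<sigma> e y\<close> times -2.\<close>
    have "\<sigma> f (br e (br e y)) = \<sigma> (br (br f e) e) y" by (simp add: inv)
    then have "\<sigma> (sc (- 2 * proj y $ q $ p) e) f = \<sigma> (sc (-2) e) y"
      using \<sigma>_cong[OF 1 refl, of f] \<sigma>_cong[OF 2 refl, of y] \<sigma>_commute[of f "br e (br e y)"]
      by simp
    then show ?thesis using ef unfolding \<sigma>_scale by simp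
  qed
  then have "x \<in> N" using ideal_with_matrix_unit[OF N _ e pq] by (simp add: N_def)
  then have "sc 2 (br x x) = 0"
    using scale_left_distrib[of 1 1 "br x x"] by (simp add: N_def \<sigma>_def)
  then show ?thesis by simp
qed

lemma dim_squares_ideal_neq_2: "dim squares_ideal \<noteq> 2"
proof
  assume "dim squares_ideal = 2"
  then have "br x x = 0" for x
    using squares_vanish squares_ideal_left_annihilated by blast
  then have "squares_ideal \<subseteq> {0}"
    by (intro squares_ideal_subset) (auto simp: alg_ideal_def br_zero_left br_zero_right)
  then have "dim squares_ideal \<le> card ({} :: 'a set)" by (intro dim_le_card) (auto simp: span_empty)
  then show False using \<open>dim squares_ideal = 2\<close> by simp
qed

end

theorem theorem5p2:
  fixes sc :: "complex \<Rightarrow> 'a::ab_group_add \<Rightarrow> 'a"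
    and br :: "'a \<Rightarrow> 'a \<Rightarrow> 'a"
  defines "I \<equiv> complex_algebra.squares_ideal sc br"
  assumes "CARD('n::finite) \<ge> 3"
    and "fd_leibniz_algebra sc br"
    and "alg_isomorphic (complex_algebra.quot_alg sc br I) (sl :: (complex^'n^'n) cplx_alg)"
    and "vector_space.dim sc I = 2"
  shows "(\<exists>S. complex_algebra.subalgebra sc br S \<and> complex_algebra.vs_complement S I) \<and>
    (\<forall>S. complex_algebra.subalgebra sc br S \<and> complex_algebra.vs_complement S I \<longrightarrow>
       alg_isomorphic (complex_algebra.sub_alg sc br S) (sl :: (complex^'n^'n) cplx_alg) \<and>
       complex_algebra.alg_direct_sum sc br S I)"
proof -
  interpret fd_leibniz_algebra sc br by fact
  have I: "alg_ideal I" unfolding I_def by (rule alg_ideal_squares_ideal)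
  obtain F where F: "alg_iso (quot_alg I) (sl :: (complex^'n^'n) cplx_alg) F"
    using assms(4) by (auto simp: alg_isomorphic_def)
  have carrier: "Carrier (quot_alg I) = range (coset I)" by (simp add: quot_alg_def)
  \<comment> \<open>The quotient map followed by the given isomorphism; injectivity of
    \<open>F\<close> identifies its kernel with \<open>I\<close>.\<close>
  define proj where "proj x = F (coset I x)" for x
  have "sl_leibniz_extension sc br proj"
  proof
    show "proj (x + y) = proj x + proj y" for x y
      using F by (auto simp: alg_iso_def carrier proj_def sl_def simp flip: quot_add[OF I])
    show "proj (sc c x) = cmat_scale c (proj x)" for c x
      using F by (auto simp: alg_iso_def carrier proj_def sl_def cmat_scale_def
        simp flip: quot_scale[OF I])
    show "proj (br x y) = commutator (proj x) (proj y)" for x y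
      using F by (auto simp: alg_iso_def carrier proj_def sl_def simp flip: quot_bracket[OF I])
    have bij: "bij_betw F (range (coset I)) {A :: complex^'n^'n. trace A = 0}"
      using F by (simp add: alg_iso_def carrier sl_def)
    then show "range proj = {A. trace A = 0}"
      by (auto simp: proj_def bij_betw_def image_image)
    show "proj x = proj y \<longleftrightarrow> x - y \<in> squares_ideal" for x y
      using bij coset_eq_iff[OF I, of x y]
      by (auto simp: proj_def bij_betw_def inj_on_eq_iff I_def)
  qed fact
  then have "dim I \<noteq> 2" unfolding I_def by (rule sl_leibniz_extension.dim_squares_ideal_neq_2)
  then show ?thesis using assms(5) by contradiction
qed

end
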